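(* Let $(T,\dashv,\vdash,\perp,\alpha,\beta)$ be a multiplicative BiHom-associative trialgebra over a field $\mathbb{F}$ and let $(V,\alpha_V,\beta_V)$ be a BiHom-module of $T$. Let $f_{\dashv},f_{\vdash},f_{\perp}:T\times T\to V$ be bilinear maps, write $F=(f_{\dashv},f_{\vdash},f_{\perp})$, and set $T_F=T\oplus V$. Define operations on $T_F$ by \[(x+u)\triangleleft(y+v)=x\dashv y+f_{\dashv}(x,y),\] \[(x+u)\triangleright(y+v)=x\vdash y+f_{\vdash}(x,y),\] \[(x+u)\diamond(y+v)=x\perp y+f_{\perp}(x,y),\] and \[(\alpha\oplus\alpha_V)(x+u)=\alpha(x)+\alpha_V(u),\qquad(\beta\oplus\beta_V)(x+u)=\beta(x)+\beta_V(u)\] for all $x,y\in T$ and $u,v\in V$. Then $(T_F,\triangleleft,\triangleright,\diamond,\alpha\oplus\alpha_V,\beta\oplus\beta_V)$ (with $\triangleleft,\triangleright,\diamond$ in the roles of $\dashv,\vdash,\perp$ respectively) is a multiplicative BiHom-associative trialgebra if and only if $F$ is a 2-cocycle on $T$ with values in $V$.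
   Context: Everything is over a field $\mathbb{F}$. A BiHom-associative trialgebra $(T,\dashv,\vdash,\perp,\alpha,\beta)$ is a vector space $T$ with linear maps $\dashv,\vdash,\perp:T\otimes T\to T$ and $\alpha,\beta:T\to T$ (the structure maps) such that $\alpha\circ\beta=\beta\circ\alpha$ and, for all $x,y,z\in T$: (1) $(x\dashv y)\dashv\beta(z)=\alpha(x)\dashv(y\dashv z)$; (2) $(x\dashv y)\dashv\beta(z)=\alpha(x)\dashv(y\vdash z)$; (3) $(x\vdash y)\dashv\beta(z)=\alpha(x)\vdash(y\dashv z)$; (4) $(x\dashv y)\vdash\beta(z)=\alpha(x)\vdash(y\vdash z)$; (5) $(x\vdash y)\vdash\beta(z)=\alpha(x)\vdash(y\vdash z)$; (6) $(x\dashv y)\dashv\beta(z)=\alpha(x)\dashv(y\perp z)$; (7) $(x\perp y)\dashv\beta(z)=\alpha(x)\perp(y\dashv z)$; (8) $(x\dashv y)\perp\beta(z)=\alpha(x)\perp(y\vdash z)$; (9) $(x\vdash y)\perp\beta(z)=\alpha(x)\vdash(y\perp z)$; (10) $(x\perp y)\vdash\beta(z)=\alpha(x)\vdash(y\vdash z)$; (11) $(x\perp y)\perp\beta(z)=\alpha(x)\perp(y\perp z)$. It is multiplicative if $\alpha$ and $\beta$ are homomorphisms, i.e. $\alpha(x\ast y)=\alpha(x)\ast\alpha(y)$ and $\beta(x\ast y)=\beta(x)\ast\beta(y)$ for all $x,y\in T$ and $\ast\in\{\dashv,\vdash,\perp\}$. A BiHom-module $(V,\alpha_V,\beta_V)$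 is a vector space $V$ with linear maps $\alpha_V,\beta_V:V\to V$ satisfying $\alpha_V\circ\beta_V=\beta_V\circ\alpha_V$. It is a BiHom-module of $T$ if there are six linear maps $\dashv,\vdash,\perp:T\otimes V\to V$ and $\dashv,\vdash,\perp:V\otimes T\to V$ satisfying the 33 axioms obtained from identities (1)–(11) by taking exactly one of $x,y,z$ in $V$ and the other two in $T$ (with $\alpha_V,\beta_V$ in place of $\alpha,\beta$ on elements of $V$), and such that $\alpha_V(x\ast v)=\alpha(x)\ast\alpha_V(v)$, $\beta_V(x\ast v)=\beta(x)\ast\beta_V(v)$, $\alpha_V(v\ast x)=\alpha_V(v)\ast\alpha(x)$, $\beta_V(v\ast x)=\beta_V(v)\ast\beta(x)$ for $x\in T$, $v\in V$, $\ast\in\{\dashv,\vdash,\perp\}$. A 2-cocycle on $T$ with values in $V$ is a triple of bilinear maps $f_{\dashv},f_{\vdash},f_{\perp}:T\times T\to V$ such that, for all $x,y,z\in T$ and $\ast\in\{\vdash,\dashv,\perp\}$: $f_\ast(\alpha(x),\alpha(y))=\alpha_V(f_\ast(x,y))$, $f_\ast(\beta(x),\beta(y))=\beta_V(f_\ast(x,y))$, and $f_{\dashv}(x\dashv y,\beta(z))=f_{\dashv}(\alpha(x),y\dashv z)$; $f_{\dashv}(x\dashv y,\beta(z))=f_{\dashv}(\alpha(x),y\vdash z)$; $f_{\dashv}(x\vdash y,\beta(z))=f_{\vdash}(\alpha(x),y\dashv z)$; $f_{\vdash}(x\dashv y,\beta(z))=f_{\vdash}(\alpha(x),y\vdash z)$;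 $f_{\vdash}(x\vdash y,\beta(z))=f_{\vdash}(\alpha(x),y\vdash z)$; $f_{\dashv}(x\dashv y,\beta(z))=f_{\dashv}(\alpha(x),y\perp z)$; $f_{\dashv}(x\perp y,\beta(z))=f_{\perp}(\alpha(x),y\dashv z)$; $f_{\perp}(x\dashv y,\beta(z))=f_{\perp}(\alpha(x),y\vdash z)$; $f_{\perp}(x\vdash y,\beta(z))=f_{\vdash}(\alpha(x),y\perp z)$; $f_{\vdash}(x\perp y,\beta(z))=f_{\vdash}(\alpha(x),y\vdash z)$; $f_{\perp}(x\perp y,\beta(z))=f_{\perp}(\alpha(x),y\perp z)$. *)

theory Defs
  imports "HOL-Analysis.Product_Vector"
begin

text \<open>Vector spaces over a field are given by a scalar multiplication on a type of class
  \<^class>\<open>ab_group_add\<close>, as in the locale \<^locale>\<open>vector_space\<close>. Linear maps out of a tensor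
  product \<open>A \<otimes> B\<close> are represented by curried bilinear maps. Operations are always listed in
  the order \<open>\<stileturn>\<close>, \<open>\<turnstile>\<close>, \<open>\<bottom>\<close>.\<close>

definition bilinear_map ::
  "('k::field \<Rightarrow> 'a::ab_group_add \<Rightarrow> 'a) \<Rightarrow> ('k \<Rightarrow> 'b::ab_group_add \<Rightarrow> 'b) \<Rightarrow>
   ('k \<Rightarrow> 'c::ab_group_add \<Rightarrow> 'c) \<Rightarrow> ('a \<Rightarrow> 'b \<Rightarrow> 'c) \<Rightarrow> bool"
  where "bilinear_map s1 s2 s3 f \<longleftrightarrow>
    (\<forall>y. Vector_Spaces.linear s1 s3 (\<lambda>x. f x y)) \<and> (\<forall>x. Vector_Spaces.linear s2 s3 (\<lambda>y. f x y))"

type_synonym ('a, 'b, 'c) triop =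
  "('a \<Rightarrow> 'b \<Rightarrow> 'c) \<times> ('a \<Rightarrow> 'b \<Rightarrow> 'c) \<times> ('a \<Rightarrow> 'b \<Rightarrow> 'c)"

text \<open>The eleven BiHom-trialgebra identities, each of the form
  \<open>(x \<cdot> y) \<cdot> b z = a x \<cdot> (y \<cdot> z)\<close>, where \<open>x\<close>, \<open>y\<close>, \<open>z\<close> may live in different spaces. The four
  triples of operations are those used for the products \<open>x \<cdot> y\<close> (index 1), \<open>(x \<cdot> y) \<cdot> b z\<close>
  (index 2), \<open>a x \<cdot> (y \<cdot> z)\<close> (index 3) and \<open>y \<cdot> z\<close> (index 4). With a single space and a single
  triple these are the axioms of the trialgebra itself; letting one of \<open>x\<close>, \<open>y\<close>, \<open>z\<close> range
  over a module gives the module axioms.\<close>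

fun trialgebra_identities ::
  "('x \<Rightarrow> 'x) \<Rightarrow> ('z \<Rightarrow> 'z) \<Rightarrow> ('x, 'y, 'xy) triop \<Rightarrow> ('xy, 'z, 'w) triop \<Rightarrow>
   ('x, 'yz, 'w) triop \<Rightarrow> ('y, 'z, 'yz) triop \<Rightarrow> bool"
  where "trialgebra_identities a b (l1, r1, p1) (l2, r2, p2) (l3, r3, p3) (l4, r4, p4) \<longleftrightarrow>
    (\<forall>x y z.
      l2 (l1 x y) (b z) = l3 (a x) (l4 y z) \<and>
      l2 (l1 x y) (b z) = l3 (a x) (r4 y z) \<and>
      l2 (r1 x y) (b z) = r3 (a x) (l4 y z) \<and>
      r2 (l1 x y) (b z) = r3 (a x) (r4 y z) \<and>
      r2 (r1 x y) (b z) = r3 (a x) (r4 y z) \<and>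
      l2 (l1 x y) (b z) = l3 (a x) (p4 y z) \<and>
      l2 (p1 x y) (b z) = p3 (a x) (l4 y z) \<and>
      p2 (l1 x y) (b z) = p3 (a x) (r4 y z) \<and>
      p2 (r1 x y) (b z) = r3 (a x) (p4 y z) \<and>
      r2 (p1 x y) (b z) = r3 (a x) (r4 y z) \<and>
      p2 (p1 x y) (b z) = p3 (a x) (p4 y z))"

definition intertwines :: "('a \<Rightarrow> 'a) \<Rightarrow> ('b \<Rightarrow> 'b) \<Rightarrow> ('c \<Rightarrow> 'c) \<Rightarrow> ('a \<Rightarrow> 'b \<Rightarrow> 'c) \<Rightarrow> bool"
  where "intertwines h1 h2 h3 f \<longleftrightarrow> (\<forall>x y. h3 (f x y) = f (h1 x) (h2 y))"

locale bihom_module = vector_space s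
  for s :: "'k::field \<Rightarrow> 'v::ab_group_add \<Rightarrow> 'v" +
  fixes \<alpha> \<beta> :: "'v \<Rightarrow> 'v"
  assumes linear_\<alpha>: "Vector_Spaces.linear s s \<alpha>"
    and linear_\<beta>: "Vector_Spaces.linear s s \<beta>"
    and \<alpha>_\<beta>_commute: "\<alpha> \<circ> \<beta> = \<beta> \<circ> \<alpha>"

locale bihom_trialgebra = bihom_module s \<alpha> \<beta>
  for s :: "'k::field \<Rightarrow> 't::ab_group_add \<Rightarrow> 't"
    and l r p :: "'t \<Rightarrow> 't \<Rightarrow> 't"
    and \<alpha> \<beta> :: "'t \<Rightarrow> 't" +
  assumes bilinear: "\<forall>f \<in> {l, r, p}. bilinear_map s s s f"
    and identities: "trialgebra_identities \<alpha> \<beta> (l, r, p) (l, r, p) (l, r, p) (l, r, p)"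

locale multiplicative_bihom_trialgebra = bihom_trialgebra s l r p \<alpha> \<beta>
  for s :: "'k::field \<Rightarrow> 't::ab_group_add \<Rightarrow> 't" and l r p \<alpha> \<beta> +
  assumes multiplicative_\<alpha>: "\<forall>f \<in> {l, r, p}. intertwines \<alpha> \<alpha> \<alpha> f"
    and multiplicative_\<beta>: "\<forall>f \<in> {l, r, p}. intertwines \<beta> \<beta> \<beta> f"

text \<open>In a BiHom-module of a trialgebra, \<open>lL, rL, pL\<close> are the actions \<open>T \<otimes> V \<rightarrow> V\<close> and
  \<open>lR, rR, pR\<close> the actions \<open>V \<otimes> T \<rightarrow> V\<close>.\<close>

locale trialgebra_bihom_module =
  T: bihom_trialgebra s l r p \<alpha> \<beta> + V: bihom_module sV \<alpha>V \<beta>V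
  for s :: "'k::field \<Rightarrow> 't::ab_group_add \<Rightarrow> 't" and l r p \<alpha> \<beta>
    and sV :: "'k \<Rightarrow> 'v::ab_group_add \<Rightarrow> 'v" and \<alpha>V \<beta>V +
  fixes lL rL pL :: "'t \<Rightarrow> 'v \<Rightarrow> 'v"
    and lR rR pR :: "'v \<Rightarrow> 't \<Rightarrow> 'v"
  assumes bilinear_left: "\<forall>f \<in> {lL, rL, pL}. bilinear_map s sV sV f"
    and bilinear_right: "\<forall>f \<in> {lR, rR, pR}. bilinear_map sV s sV f"
    and identities_x_in_V:
      "trialgebra_identities \<alpha>V \<beta> (lR, rR, pR) (lR, rR, pR) (lR, rR, pR) (l, r, p)"
    and identities_y_in_V:
      "trialgebra_identities \<alpha> \<beta> (lL, rL, pL) (lR, rR, pR) (lL, rL, pL) (lR, rR, pR)"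
    and identities_z_in_V:
      "trialgebra_identities \<alpha> \<beta>V (l, r, p) (lL, rL, pL) (lL, rL, pL) (lL, rL, pL)"
    and intertwines_\<alpha>_left: "\<forall>f \<in> {lL, rL, pL}. intertwines \<alpha> \<alpha>V \<alpha>V f"
    and intertwines_\<beta>_left: "\<forall>f \<in> {lL, rL, pL}. intertwines \<beta> \<beta>V \<beta>V f"
    and intertwines_\<alpha>_right: "\<forall>f \<in> {lR, rR, pR}. intertwines \<alpha>V \<alpha> \<alpha>V f"
    and intertwines_\<beta>_right: "\<forall>f \<in> {lR, rR, pR}. intertwines \<beta>V \<beta> \<beta>V f"

definition two_cocycle ::
  "('k::field \<Rightarrow> 't::ab_group_add \<Rightarrow> 't) \<Rightarrow> ('t \<Rightarrow> 't \<Rightarrow> 't) \<Rightarrow> ('t \<Rightarrow> 't \<Rightarrow> 't) \<Rightarrow> ('t \<Rightarrow> 't \<Rightarrow> 't) \<Rightarrow>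
   ('t \<Rightarrow> 't) \<Rightarrow> ('t \<Rightarrow> 't) \<Rightarrow> ('k \<Rightarrow> 'v::ab_group_add \<Rightarrow> 'v) \<Rightarrow> ('v \<Rightarrow> 'v) \<Rightarrow> ('v \<Rightarrow> 'v) \<Rightarrow>
   ('t, 't, 'v) triop \<Rightarrow> bool"
  where "two_cocycle s l r p \<alpha> \<beta> sV \<alpha>V \<beta>V F \<longleftrightarrow>
    (case F of (fl, fr, fp) \<Rightarrow>
      (\<forall>f \<in> {fl, fr, fp}. bilinear_map s s sV f \<and> intertwines \<alpha> \<alpha> \<alpha>V f \<and> intertwines \<beta> \<beta> \<beta>V f) \<and>
      (\<forall>x y z.
        fl (l x y) (\<beta> z) = fl (\<alpha> x) (l y z) \<and>
        fl (l x y) (\<beta> z) = fl (\<alpha> x) (r y z) \<and>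
        fl (r x y) (\<beta> z) = fr (\<alpha> x) (l y z) \<and>
        fr (l x y) (\<beta> z) = fr (\<alpha> x) (r y z) \<and>
        fr (r x y) (\<beta> z) = fr (\<alpha> x) (r y z) \<and>
        fl (l x y) (\<beta> z) = fl (\<alpha> x) (p y z) \<and>
        fl (p x y) (\<beta> z) = fp (\<alpha> x) (l y z) \<and>
        fp (l x y) (\<beta> z) = fp (\<alpha> x) (r y z) \<and>
        fp (r x y) (\<beta> z) = fr (\<alpha> x) (p y z) \<and>
        fr (p x y) (\<beta> z) = fr (\<alpha> x) (r y z) \<and>
        fp (p x y) (\<beta> z) = fp (\<alpha> x) (p y z)))"

text \<open>The product on \<open>T \<oplus> V\<close>, modelled by the product type with scalar multiplication
  \<^const>\<open>module_prod.scale\<close>. It does not involve the actions of \<open>T\<close> on \<open>V\<close>.\<close>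

definition extend_op :: "('t \<Rightarrow> 't \<Rightarrow> 't) \<Rightarrow> ('t \<Rightarrow> 't \<Rightarrow> 'v) \<Rightarrow> 't \<times> 'v \<Rightarrow> 't \<times> 'v \<Rightarrow> 't \<times> 'v"
  where "extend_op m f = (\<lambda>(x, u) (y, v). (m x y, f x y))"

end

theory Submission
  imports Defs
begin

text \<open>The \<open>T\<close>-component of every axiom for \<open>T \<oplus> V\<close> is the corresponding axiom for \<open>T\<close>, and the
  \<open>V\<close>-component is the corresponding cocycle condition on \<open>F\<close>.\<close>

text \<open>The locale facts about \<open>module_prod.scale\<close> are exported with explicit
  vector space premises, so that they can serve as conditional rewrite rules for maps between
  product spaces.\<close>

lemma vector_space_prod_scale:
  assumes "vector_space s1" and "vector_space s2"
  shows "vector_space (module_prod.scale s1 s2)"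
    and "module_prod.scale s1 s2 c (x, y) = (s1 c x, s2 c y)"
proof -
  interpret vector_space_prod s1 s2
    using assms by (simp add: vector_space_prod_def vector_space_pair_def)
  show "vector_space (module_prod.scale s1 s2)" by unfold_locales
  show "module_prod.scale s1 s2 c (x, y) = (s1 c x, s2 c y)" by (fact scale_prod)
qed

lemma linear_map_prod:
  assumes "Vector_Spaces.linear s1 s1' g" and "Vector_Spaces.linear s2 s2' h"
  shows "Vector_Spaces.linear (module_prod.scale s1 s2) (module_prod.scale s1' s2') (map_prod g h)"
  using assms
  by (auto simp: Vector_Spaces.linear_iff vector_space_prod_scale)

text \<open>The product depends only on the first components of its arguments, and projecting to
  them is linear; so additivity and homogeneity in each argument come directly from those of
  \<open>m\<close> and \<open>f\<close>.\<close>

lemma bilinear_map_extend_op: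
  assumes "bilinear_map s s s m" and "bilinear_map s s sV f" and "vector_space sV"
  shows "bilinear_map (module_prod.scale s sV) (module_prod.scale s sV) (module_prod.scale s sV)
    (extend_op m f)"
  using assms
  by (auto simp: bilinear_map_def Vector_Spaces.linear_iff vector_space_prod_scale extend_op_def)

lemma intertwines_extend_op_iff:
  "intertwines (map_prod g h) (map_prod g h) (map_prod g h) (extend_op m f) \<longleftrightarrow>
    intertwines g g g m \<and> intertwines g g h f"
  by (auto simp: intertwines_def extend_op_def)

text \<open>In an iterated product the outer operation discards the \<open>V\<close>-component of
  the inner one, and likewise the values of \<alpha>V and \<beta>V. Each \<open>V\<close>-component
  therefore has an outer operation from \<open>F\<close> and an inner one from \<open>T\<close>,
  which is why \<open>F\<close> fills slots 2 and 3 and the operations of \<open>T\<close> fill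
  slots 1 and 4.\<close>

lemma trialgebra_identities_extend_op_iff:
  fixes l r p :: "'t \<Rightarrow> 't \<Rightarrow> 't" and fl fr fp :: "'t \<Rightarrow> 't \<Rightarrow> 'v"
  defines "E \<equiv> (extend_op l fl, extend_op r fr, extend_op p fp)"
  shows "trialgebra_identities (map_prod \<alpha> \<alpha>V) (map_prod \<beta> \<beta>V) E E E E \<longleftrightarrow>
    trialgebra_identities \<alpha> \<beta> (l, r, p) (l, r, p) (l, r, p) (l, r, p) \<and>
    trialgebra_identities \<alpha> \<beta> (l, r, p) (fl, fr, fp) (fl, fr, fp) (l, r, p)"
  \<comment> \<open>Once the pairs are split, the quantifiers over \<open>V\<close>-components bind
    nothing, and only a regrouping of conjunctions remains.\<close>
  unfolding E_def trialgebra_identities.simps extend_op_def split_paired_All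
    map_prod_simp case_prod_conv prod.inject
  by blast

theorem theorem3p3:
  fixes s :: "'k::field \<Rightarrow> 't::ab_group_add \<Rightarrow> 't"
    and l r p :: "'t \<Rightarrow> 't \<Rightarrow> 't"
    and \<alpha> \<beta> :: "'t \<Rightarrow> 't"
    and sV :: "'k \<Rightarrow> 'v::ab_group_add \<Rightarrow> 'v"
    and \<alpha>V \<beta>V :: "'v \<Rightarrow> 'v"
    and lL rL pL :: "'t \<Rightarrow> 'v \<Rightarrow> 'v"
    and lR rR pR :: "'v \<Rightarrow> 't \<Rightarrow> 'v"
    and fl fr fp :: "'t \<Rightarrow> 't \<Rightarrow> 'v"
  assumes "multiplicative_bihom_trialgebra s l r p \<alpha> \<beta>"
    and "trialgebra_bihom_module s l r p \<alpha> \<beta> sV \<alpha>V \<beta>V lL rL pL lR rR pR"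
    and "bilinear_map s s sV fl"
    and "bilinear_map s s sV fr"
    and "bilinear_map s s sV fp"
  shows "multiplicative_bihom_trialgebra (module_prod.scale s sV)
           (extend_op l fl) (extend_op r fr) (extend_op p fp)
           (map_prod \<alpha> \<alpha>V) (map_prod \<beta> \<beta>V)
         \<longleftrightarrow> two_cocycle s l r p \<alpha> \<beta> sV \<alpha>V \<beta>V (fl, fr, fp)"
proof -
  interpret T: multiplicative_bihom_trialgebra s l r p \<alpha> \<beta> by fact
  interpret M: trialgebra_bihom_module s l r p \<alpha> \<beta> sV \<alpha>V \<beta>V lL rL pL lR rR pR by fact
  let ?S = "module_prod.scale s sV" and ?A = "map_prod \<alpha> \<alpha>V" and ?B = "map_prod \<beta> \<beta>V"
  let ?l = "extend_op l fl" and ?r = "extend_op r fr" and ?p = "extend_op p fp"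
  have "?A \<circ> ?B = ?B \<circ> ?A"
    by (simp add: map_prod_compose[symmetric] T.\<alpha>_\<beta>_commute M.V.\<alpha>_\<beta>_commute)
  then have module: "bihom_module ?S ?A ?B"
    by (intro bihom_module.intro bihom_module_axioms.intro vector_space_prod_scale(1) linear_map_prod
        T.vector_space_axioms M.V.vector_space_axioms T.linear_\<alpha> T.linear_\<beta> M.V.linear_\<alpha> M.V.linear_\<beta>)
  have bilinear: "\<forall>m \<in> {?l, ?r, ?p}. bilinear_map ?S ?S ?S m"
    using T.bilinear assms(3-5) M.V.vector_space_axioms by (auto intro: bilinear_map_extend_op)
  \<comment> \<open>The linear structure is settled by \<open>module\<close> and
    \<open>bilinear\<close>, and the \<open>T\<close>-halves of the split axioms hold in
    \<open>T\<close>, so only the \<open>V\<close>-halves survive. The identities stay folded to let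
    the splitting lemma match.\<close>
  have "multiplicative_bihom_trialgebra ?S ?l ?r ?p ?A ?B \<longleftrightarrow>
    trialgebra_identities \<alpha> \<beta> (l, r, p) (fl, fr, fp) (fl, fr, fp) (l, r, p) \<and>
    (\<forall>f \<in> {fl, fr, fp}. intertwines \<alpha> \<alpha> \<alpha>V f \<and> intertwines \<beta> \<beta> \<beta>V f)"
    using module bilinear T.identities T.multiplicative_\<alpha> T.multiplicative_\<beta>
    by (auto simp: multiplicative_bihom_trialgebra_def multiplicative_bihom_trialgebra_axioms_def
        bihom_trialgebra_def bihom_trialgebra_axioms_def intertwines_extend_op_iff
        trialgebra_identities_extend_op_iff simp del: trialgebra_identities.simps)
  \<comment> \<open>The eleven equations agree clause by clause; the bilinearity clause of a cocycle
    is supplied by the hypotheses on \<open>fl\<close>, \<open>fr\<close>,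
    \<open>fp\<close>.\<close>
  also have "\<dots> \<longleftrightarrow> two_cocycle s l r p \<alpha> \<beta> sV \<alpha>V \<beta>V (fl, fr, fp)"
    unfolding two_cocycle_def trialgebra_identities.simps prod.case using assms(3-5) by blast
  finally show ?thesis .
qed

end
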